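(* Let $k$ be a positive integer. A subgraph ideal $\mathcal C$ is vertex $k$-scattered if and only if, for every connected graph $H$ with exactly $k+1$ edges and every independent set $A\subsetneq V(H)$ of $H$ such that $H-A$ is connected, \[\{1H/A,\ 2H/A,\ 3H/A,\ 4H/A,\ \ldots\}\not\subseteq \mathcal C.\]
   Context: All graphs are finite, undirected and simple. For a finite set $X$ and $f:2^X\to\mathbb Z$, the $f$-width of a partition $(X_1,\ldots,X_m)$ of $X$ is $\max\{f(\bigcup_{i\in I}X_i): I\subseteq\{1,\ldots,m\}\}$; the $k$-brittleness of $f$ is the minimum $f$-width over all partitions of $X$ into parts of size at most $k$. For a graph $G$ and $F\subseteq E(G)$, let $\kappa_G(F)$ be the number of vertices incident with both an edge in $F$ and an edge not in $F$. The vertex $k$-brittleness of $G$ is the $k$-brittleness of $\kappa_G:2^{E(G)}\to\mathbb Z$. A class $\mathcal C$ of graphs is vertex $k$-scattered if the vertex $k$-brittleness of graphs in $\mathcal C$ is bounded (by a constant depending only on $\mathcal C$). A class $\mathcal C$ of graphs is a subgraph ideal if it contains every graph isomorphic to a subgraph of a graph in $\mathcal C$. $mH$ denotes the disjoint union of $m$ copies of $H$. A set of vertices is independent if no two of its vertices are adjacent (the empty set is independent). For an independent set $A\subsetneq V(H)$, $mH/A$ is the graph obtained from $mH$ by identifying, for each vertex of $A$, all of its $m$ copies into one vertex; so $mH/A$ has $m(|V(H)|-|A|)+|A|$ vertices and $1H/A=H$. $H-A$ is the graph obtained from $H$ by deleting all vertices in $A$. *)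

theory Defs
  imports Main "HOL-Library.Disjoint_Sets"
begin

section \<open>Brittleness of set functions\<close>

text \<open>
  Partitions are \<^const>\<open>partition_on\<close>, so parts are nonempty; admitting empty parts
  would add no new unions of parts. All notions are meant for finite ground sets \<open>X\<close>, and
  \<open>brittleness\<close> for \<open>k \<ge> 1\<close>: then the minimum is over a finite nonempty set.
\<close>

definition f_width :: "('a set \<Rightarrow> int) \<Rightarrow> 'a set set \<Rightarrow> int" where
  "f_width f P = Max {f (\<Union>Q) | Q. Q \<subseteq> P}"

definition brittleness :: "nat \<Rightarrow> 'a set \<Rightarrow> ('a set \<Rightarrow> int) \<Rightarrow> int" where
  "brittleness k X f = Min {f_width f P | P. partition_on X P \<and> (\<forall>p\<in>P. card p \<le> k)}"

section \<open>Finite simple graphs\<close>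

datatype 'a graph = Graph (verts: "'a set") (edges: "'a set set")

definition simple_graph :: "'a graph \<Rightarrow> bool" where
  "simple_graph G \<longleftrightarrow> finite (verts G) \<and> (\<forall>e\<in>edges G. e \<subseteq> verts G \<and> card e = 2)"

definition subgraph_of :: "'a graph \<Rightarrow> 'a graph \<Rightarrow> bool" where
  "subgraph_of S G \<longleftrightarrow> simple_graph S \<and> verts S \<subseteq> verts G \<and> edges S \<subseteq> edges G"

definition map_verts :: "('a \<Rightarrow> 'b) \<Rightarrow> 'a graph \<Rightarrow> 'b graph" where
  "map_verts f G = Graph (f ` verts G) ((`) f ` edges G)"

definition graph_isomorphic :: "'a graph \<Rightarrow> 'b graph \<Rightarrow> bool" where
  "graph_isomorphic G H \<longleftrightarrow> (\<exists>f. inj_on f (verts G) \<and> map_verts f G = H)"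

definition graph_connected :: "'a graph \<Rightarrow> bool" where
  "graph_connected G \<longleftrightarrow> verts G \<noteq> {} \<and>
     (\<forall>u\<in>verts G. \<forall>v\<in>verts G. (u, v) \<in> {(x, y). {x, y} \<in> edges G}\<^sup>*)"

definition independent_in :: "'a graph \<Rightarrow> 'a set \<Rightarrow> bool" where
  "independent_in G A \<longleftrightarrow> A \<subseteq> verts G \<and> (\<forall>u\<in>A. \<forall>v\<in>A. {u, v} \<notin> edges G)"

definition delete_verts :: "'a graph \<Rightarrow> 'a set \<Rightarrow> 'a graph" where
  "delete_verts G A = Graph (verts G - A) {e \<in> edges G. e \<inter> A = {}}"

definition disjoint_copies :: "nat \<Rightarrow> 'a graph \<Rightarrow> ('a \<times> nat) graph" where
  "disjoint_copies m H =
     Graph (verts H \<times> {..<m}) {(\<lambda>v. (v, i)) ` e | e i. e \<in> edges H \<and> i < m}"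

text \<open>
  \<open>glued_copies m H A\<close> is \<open>mH/A\<close>: all copies \<open>(v, i)\<close> of a vertex \<open>v \<in> A\<close> are
  identified, with \<open>(v, 0)\<close> naming the resulting vertex.
\<close>

definition glued_copies :: "nat \<Rightarrow> 'a graph \<Rightarrow> 'a set \<Rightarrow> ('a \<times> nat) graph" where
  "glued_copies m H A =
     map_verts (\<lambda>(v, i). if v \<in> A then (v, 0) else (v, i)) (disjoint_copies m H)"

section \<open>Vertex brittleness and classes of graphs\<close>

definition kappa :: "'a graph \<Rightarrow> 'a set set \<Rightarrow> int" where
  "kappa G F =
     int (card {v \<in> verts G. (\<exists>e\<in>F. v \<in> e) \<and> (\<exists>e\<in>edges G - F. v \<in> e)})"

definition vertex_brittleness :: "nat \<Rightarrow> 'a graph \<Rightarrow> int" where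
  "vertex_brittleness k G = brittleness k (edges G) (kappa G)"

definition vertex_scattered :: "nat \<Rightarrow> 'a graph set \<Rightarrow> bool" where
  "vertex_scattered k C \<longleftrightarrow> (\<exists>b. \<forall>G\<in>C. vertex_brittleness k G \<le> b)"

text \<open>
  A class of graphs is represented by its members with vertices in a fixed infinite type such as
  \<^typ>\<open>nat\<close>. A subgraph ideal is closed under isomorphism, so this loses nothing, and a
  graph over another vertex type belongs to the class iff an isomorphic copy of it is a member.
\<close>

definition subgraph_ideal :: "'a graph set \<Rightarrow> bool" where
  "subgraph_ideal C \<longleftrightarrow> (\<forall>G\<in>C. simple_graph G) \<and>
     (\<forall>G\<in>C. \<forall>S H. subgraph_of S G \<and> simple_graph H \<and> graph_isomorphic H S \<longrightarrow> H \<in> C)"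

definition in_class :: "'b graph \<Rightarrow> 'a graph set \<Rightarrow> bool" where
  "in_class G C \<longleftrightarrow> (\<exists>G'\<in>C. graph_isomorphic G G')"

end

theory Submission
  imports Defs "HOL-Library.Ramsey"
begin

text \<open>
  If the class contains \<open>mH/A\<close>, consider any partition of its edges into parts of size at
  most \<open>k\<close>. No part contains the \<open>k + 1\<close> edges of a whole copy of \<open>H\<close>. Since \<open>H - A\<close>
  is connected and every edge has an end in it, each copy has a vertex outside \<open>A\<close> that is
  incident with two different parts. The \<open>m\<close> vertices found in this way are distinct, and a
  maximum-cut argument gives a union of parts that cuts at least half of them. So the brittleness
  of \<open>mH/A\<close> is at least \<open>m/2\<close> (\<open>brittleness_of_glued_copies\<close>).

  Conversely, call a set of edges linked outside \<open>X\<close> if any two of its edges are joined by a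
  chain of its edges in which consecutive edges share a vertex not in \<open>X\<close>. For a set
  \<open>X\<close> of vertices of \<open>G\<close>, the maximal linked sets of edges form a partition in which only
  vertices of \<open>X\<close> meet more than one part. If \<open>G\<close> has brittleness larger than
  \<open>card X\<close>, one of these parts must therefore have more than \<open>k\<close> edges, and it contains a
  linked set of exactly \<open>k + 1\<close> edges. Adding the ends of these edges to \<open>X\<close> and repeating,
  a graph of large brittleness yields a long sequence of sets of \<open>k + 1\<close> edges, each linked
  outside the vertices of the earlier ones (\<open>linked_sequence_of_brittle\<close>).

  By Ramsey's theorem, a long sequence contains \<open>M\<close> such sets that form a sunflower of
  isomorphic graphs, in which any two meet exactly in a common kernel
  (\<open>sunflower_of_linked_sequence\<close>). Let \<open>H\<close> be the common isomorphism type and \<open>A\<close> the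
  kernel. The kernel consists of vertices used earlier, so \<open>H\<close> is linked outside \<open>A\<close>. This
  is precisely what makes \<open>H\<close> and \<open>H - A\<close> connected and \<open>A\<close> an independent proper
  subset of the vertices (\<open>valid_pair_of_linked\<close>), and the sunflower is a copy of \<open>MH/A\<close>
  in \<open>G\<close>. There are only finitely many pairs \<open>(H, A)\<close> up to isomorphism, so if each of them
  has some \<open>mH/A\<close> outside the class, then one \<open>M\<close> bounds all these \<open>m\<close>, and the
  brittleness of the graphs in the class is bounded.
\<close>

section \<open>Bounding brittleness\<close>

lemma finite_edges: "simple_graph G \<Longrightarrow> finite (edges G)"
  unfolding simple_graph_def by (meson Pow_iff finite_Pow_iff finite_subset subsetI)

lemma finite_widths:
  assumes "finite X"
  shows "finite {f_width f P | P. partition_on X P \<and> (\<forall>p\<in>P. card p \<le> k)}"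
proof (rule finite_subset)
  show "{f_width f P | P. partition_on X P \<and> (\<forall>p\<in>P. card p \<le> k)} \<subseteq> f_width f ` {P. partition_on X P}"
    by auto
qed (use assms finitely_many_partition_on in auto)

lemma brittleness_le:
  assumes "finite X" "partition_on X P" "\<And>p. p \<in> P \<Longrightarrow> card p \<le> k"
    and "\<And>Q. Q \<subseteq> P \<Longrightarrow> f (\<Union>Q) \<le> b"
  shows "brittleness k X f \<le> b"
proof -
  have "finite P" using assms(1,2) by (rule finite_elements)
  then have "f_width f P \<le> b"
    unfolding f_width_def using assms(4) by (subst Max_le_iff) (auto)
  moreover have "brittleness k X f \<le> f_width f P"
    unfolding brittleness_def using assms finite_widths[OF assms(1)] by (intro Min_le) auto
  ultimately show ?thesis by simp
qed

lemma brittleness_ge: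
  assumes "finite X" "k \<ge> 1"
    and "\<And>P. partition_on X P \<Longrightarrow> (\<And>p. p \<in> P \<Longrightarrow> card p \<le> k) \<Longrightarrow> \<exists>Q\<subseteq>P. b \<le> f (\<Union>Q)"
  shows "b \<le> brittleness k X f"
proof -
  have "b \<le> f_width f P" if P: "partition_on X P" "\<forall>p\<in>P. card p \<le> k" for P
  proof -
    obtain Q where "Q \<subseteq> P" "b \<le> f (\<Union>Q)" using assms(3) P by blast
    moreover have "finite P" using assms(1) P(1) by (rule finite_elements)
    ultimately show ?thesis
      unfolding f_width_def by (subst Max_ge_iff) auto
  qed
  moreover have "partition_on X ((\<lambda>x. {x}) ` X)" by (rule partition_on_singletons)
  ultimately show ?thesis
    unfolding brittleness_def using assms(2) finite_widths[OF assms(1)]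
    by (subst Min_ge_iff) (auto intro!: exI[of _ "(\<lambda>x. {x}) ` X"])
qed

section \<open>Glued copies of a graph are brittle\<close>

text \<open>
  The maximum cut of a multigraph contains at least half of its edges: add the vertices of
  \<open>P\<close> one by one, each on the better side. It provides one union of parts that splits many
  vertices at once.
\<close>

lemma half_of_pairs_separated:
  assumes "finite P" and "finite I"
    and "\<And>i. i \<in> I \<Longrightarrow> a i \<in> P \<and> b i \<in> P \<and> a i \<noteq> b i"
  shows "\<exists>Q\<subseteq>P. card I \<le> 2 * card {i\<in>I. (a i \<in> Q) \<noteq> (b i \<in> Q)}"
  using assms
proof (induction P arbitrary: I rule: finite_induct)
  case empty
  then show ?case by (metis card.empty equals0D le0 subset_refl equals0I)
next
  case (insert x P)
  define I1 where "I1 = {i\<in>I. a i \<noteq> x \<and> b i \<noteq> x}"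
  define I2 where "I2 = {i\<in>I. a i = x \<or> b i = x}"
  have fin: "finite I1" "finite I2" using insert.prems by (auto simp: I1_def I2_def)
  have "I = I1 \<union> I2" "I1 \<inter> I2 = {}" by (auto simp: I1_def I2_def)
  then have cardI: "card I = card I1 + card I2" using fin by (simp add: card_Un_disjoint)
  have "\<exists>Q\<subseteq>P. card I1 \<le> 2 * card {i\<in>I1. (a i \<in> Q) \<noteq> (b i \<in> Q)}"
    using fin(1) insert.prems(2) by (intro insert.IH) (force simp: I1_def)+
  then obtain Q where Q: "Q \<subseteq> P" "card I1 \<le> 2 * card {i\<in>I1. (a i \<in> Q) \<noteq> (b i \<in> Q)}"
    by blast
  define S where "S R J = {i\<in>J. (a i \<in> R) \<noteq> (b i \<in> R)}" for R J
  have split: "card (S R I) = card (S R I1) + card (S R I2)" for R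
  proof -
    have "S R I = S R I1 \<union> S R I2" "S R I1 \<inter> S R I2 = {}"
      by (auto simp: I1_def I2_def S_def)
    moreover have "finite (S R I1)" "finite (S R I2)" using fin by (auto simp: S_def)
    ultimately show ?thesis by (simp add: card_Un_disjoint)
  qed
  have same: "S (insert x Q) I1 = S Q I1" by (auto simp: S_def I1_def)
  have neq: "a i \<noteq> b i" if "i \<in> I" for i using insert.prems(2) that by blast
  have xQ: "x \<notin> Q" using Q insert.hyps by auto
  \<comment> \<open>Exactly one end of each pair in \<open>I2\<close> is \<open>x\<close>, so adding \<open>x\<close> to \<open>Q\<close>
    toggles whether the pair is separated.\<close>
  have "(a i \<in> insert x Q) \<noteq> (b i \<in> insert x Q) \<longleftrightarrow> \<not> ((a i \<in> Q) \<noteq> (b i \<in> Q))"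
    if "i \<in> I2" for i
    using neq[of i] that xQ by (auto simp: I2_def)
  then have "I2 = S Q I2 \<union> S (insert x Q) I2" "S Q I2 \<inter> S (insert x Q) I2 = {}"
    unfolding S_def by blast+
  moreover have "finite (S Q I2)" "finite (S (insert x Q) I2)" using fin by (auto simp: S_def)
  ultimately have "card I2 = card (S Q I2) + card (S (insert x Q) I2)"
    by (metis card_Un_disjoint)
  then have "card I \<le> 2 * card (S Q I) \<or> card I \<le> 2 * card (S (insert x Q) I)"
    using Q(2)[folded S_def] cardI split[of Q] split[of "insert x Q"] same by arith
  then show ?case using Q(1) unfolding S_def by blast
qed

text \<open>
  Labels that agree around every vertex outside \<open>A\<close> agree along walks in \<open>H - A\<close>. Every
  edge has an end outside \<open>A\<close>, since \<open>A\<close> is independent, so one label reaches all edges.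
\<close>

lemma edge_labels_constant:
  assumes "simple_graph H" and "independent_in H A" and "graph_connected (delete_verts H A)"
    and local: "\<And>v e f. v \<in> verts H - A \<Longrightarrow> e \<in> edges H \<Longrightarrow> f \<in> edges H \<Longrightarrow> v \<in> e \<Longrightarrow> v \<in> f
      \<Longrightarrow> c e = c f"
    and "e \<in> edges H" and "f \<in> edges H"
  shows "c e = c f"
proof -
  have outside: "\<exists>v. v \<in> e \<and> v \<in> verts H - A" if e: "e \<in> edges H" for e
  proof -
    obtain u v where "e = {u, v}" "e \<subseteq> verts H"
      using assms(1) e by (auto simp: simple_graph_def card_2_iff)
    then show ?thesis using assms(2) e by (auto simp: independent_in_def)
  qed
  obtain u v where u: "u \<in> e" "u \<in> verts H - A" and v: "v \<in> f" "v \<in> verts H - A"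
    using outside assms(5,6) by blast
  have "(u, v) \<in> {(x, y). {x, y} \<in> edges (delete_verts H A)}\<^sup>*"
    using assms(3) u v by (simp add: graph_connected_def delete_verts_def)
  then have "\<forall>g\<in>edges H. v \<in> g \<longrightarrow> c e = c g"
  proof (induction rule: rtrancl_induct)
    case base
    then show ?case using local[OF u(2) assms(5) _ u(1)] by blast
  next
    case (step y z)
    have yz: "{y, z} \<in> edges H" "y \<notin> A" "z \<notin> A"
      using step.hyps by (auto simp: delete_verts_def)
    then have "z \<in> verts H - A" using assms(1) by (auto simp: simple_graph_def)
    moreover have "c e = c {y, z}" using step.IH yz by blast
    ultimately have "c {y, z} = c g" if "g \<in> edges H" "z \<in> g" for g
      using local[of z "{y, z}" g] yz(1) that by simp
    then show ?case using \<open>c e = c {y, z}\<close> by simp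
  qed
  then show ?thesis using v assms(6) by blast
qed

text \<open>
  The identification map from the \<open>i\<close>-th copy of \<open>H\<close> to \<open>mH/A\<close>.
\<close>

definition glue :: "'a set \<Rightarrow> nat \<Rightarrow> 'a \<Rightarrow> 'a \<times> nat" where
  "glue A i v = (if v \<in> A then (v, 0) else (v, i))"

lemma glue_eq_iff: "glue A i v = glue A j w \<longleftrightarrow> v = w \<and> (v \<in> A \<or> i = j)"
  by (auto simp: glue_def)

lemma verts_glued_copies: "verts (glued_copies m H A) = (\<Union>i<m. glue A i ` verts H)"
proof -
  have "(\<lambda>(v, j). if v \<in> A then (v, 0) else (v, j)) (v, i) = glue A i v" for v :: 'a and i :: nat
    by (simp add: glue_def)
  then show ?thesis
    unfolding glued_copies_def disjoint_copies_def map_verts_def graph.sel by fastforce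
qed

lemma edges_glued_copies: "edges (glued_copies m H A) = (\<Union>i<m. (`) (glue A i) ` edges H)"
proof -
  have "(\<lambda>(v, j). if v \<in> A then (v, 0) else (v, j)) ` (\<lambda>v. (v, i)) ` e = glue A i ` e"
    for e :: "'a set" and i :: nat
    by (simp add: image_image glue_def)
  moreover have "{(\<lambda>v. (v, i)) ` e | e i. e \<in> edges H \<and> i < m}
      = (\<Union>i<m. (`) (\<lambda>v. (v, i)) ` edges H)"
    by blast
  ultimately show ?thesis
    by (simp add: glued_copies_def disjoint_copies_def map_verts_def image_UN image_image)
qed

text \<open>
  A copy of \<open>H\<close> has one edge too many to fit into a part, so by
  \<open>edge_labels_constant\<close> it has a vertex outside \<open>A\<close> that meets two parts. The \<open>m\<close>
  vertices obtained from the \<open>m\<close> copies are distinct because vertices outside \<open>A\<close> are not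
  identified, and some union of parts cuts at least half of them.
\<close>

lemma brittleness_of_glued_copies:
  fixes G :: "'b graph"
  assumes k: "k \<ge> 1" and H: "simple_graph H" "card (edges H) = k + 1"
    and A: "independent_in H A" "graph_connected (delete_verts H A)"
    and G: "simple_graph G" "graph_isomorphic (glued_copies m H A) G"
  shows "int m \<le> 2 * vertex_brittleness k G"
proof -
  obtain f where f: "inj_on f (verts (glued_copies m H A))" "map_verts f (glued_copies m H A) = G"
    using G(2) by (auto simp: graph_isomorphic_def)
  define h where "h i v = f (glue A i v)" for i v
  have h_eq: "v = w \<and> (v \<in> A \<or> i = j)"
    if "h i v = h j w" "v \<in> verts H" "w \<in> verts H" "i < m" "j < m" for i j v w
  proof -
    have "glue A i v = glue A j w"
      using that(1) unfolding h_def
      by (rule inj_onD[OF f(1)]) (use that in \<open>auto simp: verts_glued_copies\<close>)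
    then show ?thesis by (auto simp: glue_eq_iff)
  qed
  have vertsG: "h i v \<in> verts G" if "v \<in> verts H" "i < m" for i v
  proof -
    have "verts G = f ` (\<Union>i<m. glue A i ` verts H)"
      by (simp add: f(2)[symmetric] map_verts_def verts_glued_copies)
    then show ?thesis using that unfolding h_def by blast
  qed
  have edgesG: "h i ` e \<in> edges G" if "e \<in> edges H" "i < m" for i e
  proof -
    have "edges G = (`) f ` (\<Union>i<m. (`) (glue A i) ` edges H)"
      by (simp add: f(2)[symmetric] map_verts_def edges_glued_copies)
    moreover have "h i ` e = f ` glue A i ` e" by (simp add: h_def image_image)
    ultimately show ?thesis using that by blast
  qed
  have finE: "finite (edges G)" using G(1) by (rule finite_edges)
  have "\<exists>Q\<subseteq>P. int ((m + 1) div 2) \<le> kappa G (\<Union>Q)"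
    if P: "partition_on (edges G) P" and small: "\<And>p. p \<in> P \<Longrightarrow> card p \<le> k" for P
  proof -
    have finP: "finite P" using finE P by (rule finite_elements)
    have part: "\<exists>!p. p \<in> P \<and> e \<in> p" if "e \<in> edges G" for e
      using P that by (auto simp: partition_on_def disjoint_def)
    define c where "c e = (THE p. p \<in> P \<and> e \<in> p)" for e
    have c: "c e \<in> P" "e \<in> c e" if "e \<in> edges G" for e
      using theI'[OF part[OF that]] by (auto simp: c_def)
    have c_unique: "c e = p" if "p \<in> P" "e \<in> p" for e p
      using P that part c unfolding partition_on_def by (metis UnionI)
    have "\<exists>v e e'. v \<in> verts H - A \<and> e \<in> edges H \<and> e' \<in> edges H \<and> v \<in> e \<and> v \<in> e'
        \<and> c (h i ` e) \<noteq> c (h i ` e')" if i: "i < m" for i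
    proof (rule ccontr)
      assume no: "\<not> ?thesis"
      have const: "c (h i ` e) = c (h i ` e')" if "e \<in> edges H" "e' \<in> edges H" for e e'
        by (rule edge_labels_constant[OF H(1) A(1,2), of "\<lambda>e. c (h i ` e)"])
          (use no that in blast)+
      obtain e0 where e0: "e0 \<in> edges H" using H(2) by fastforce
      have "(`) (h i) ` edges H \<subseteq> c (h i ` e0)"
      proof (intro image_subsetI)
        fix e assume e: "e \<in> edges H"
        then show "h i ` e \<in> c (h i ` e0)"
          using c(2)[OF edgesG[OF e i]] const[OF e e0] by simp
      qed
      moreover have "card ((`) (h i) ` edges H) = card (edges H)"
      proof (rule card_image)
        have "inj_on (h i) (verts H)" using h_eq i by (meson inj_onI)
        then show "inj_on ((`) (h i)) (edges H)"
          using H(1) by (intro inj_on_subset[OF inj_on_image_Pow]) (auto simp: simple_graph_def)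
      qed
      moreover have "c (h i ` e0) \<in> P" using c edgesG e0 i by blast
      moreover then have "finite (c (h i ` e0))"
        using finE partition_onD1[OF P] by (metis Sup_upper finite_subset)
      ultimately have "k + 1 \<le> card (c (h i ` e0))" using H(2) by (metis card_mono)
      then show False using small \<open>c (h i ` e0) \<in> P\<close> by fastforce
    qed
    then obtain v e e' where split: "\<And>i. i < m \<Longrightarrow> v i \<in> verts H - A \<and> e i \<in> edges H \<and> e' i \<in> edges H
        \<and> v i \<in> e i \<and> v i \<in> e' i \<and> c (h i ` e i) \<noteq> c (h i ` e' i)"
      by metis
    define S where "S Q = {i\<in>{..<m}. (c (h i ` e i) \<in> Q) \<noteq> (c (h i ` e' i) \<in> Q)}" for Q
    have "\<exists>Q\<subseteq>P. card {..<m} \<le> 2 * card (S Q)"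
      unfolding S_def
    proof (rule half_of_pairs_separated[OF finP finite_lessThan])
      fix i assume "i \<in> {..<m}"
      then show "c (h i ` e i) \<in> P \<and> c (h i ` e' i) \<in> P \<and> c (h i ` e i) \<noteq> c (h i ` e' i)"
        using split[of i] c(1) edgesG by blast
    qed
    then obtain Q where Q: "Q \<subseteq> P" and half: "card {..<m} \<le> 2 * card (S Q)"
      by blast
    define J where "J = S Q"
    have in_Q: "d \<in> \<Union>Q \<longleftrightarrow> c d \<in> Q" if "d \<in> edges G" for d
      using c_unique c(2)[OF that] Q by blast
    define B where
      "B = {v \<in> verts G. (\<exists>e\<in>\<Union>Q. v \<in> e) \<and> (\<exists>e\<in>edges G - \<Union>Q. v \<in> e)}"
    have "(\<lambda>i. h i (v i)) ` J \<subseteq> B"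
    proof
      fix x assume "x \<in> (\<lambda>i. h i (v i)) ` J"
      then obtain i where i: "i < m" "x = h i (v i)" "(c (h i ` e i) \<in> Q) \<noteq> (c (h i ` e' i) \<in> Q)"
        by (auto simp: J_def S_def)
      have s: "x \<in> h i ` e i" "x \<in> h i ` e' i" "x \<in> verts G"
        "h i ` e i \<in> edges G" "h i ` e' i \<in> edges G"
        using split[OF i(1)] i(1,2) edgesG vertsG by auto
      then show "x \<in> B" using i(3) in_Q unfolding B_def by blast
    qed
    moreover have "inj_on (\<lambda>i. h i (v i)) J"
    proof (rule inj_onI)
      fix i j assume ij: "i \<in> J" "j \<in> J" and eq: "h i (v i) = h j (v j)"
      then have "i < m" "j < m" by (auto simp: J_def S_def)
      then show "i = j" using h_eq[OF eq] split by blast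
    qed
    moreover have "finite B" using G(1) by (auto simp: B_def simple_graph_def)
    ultimately have "card J \<le> card B" by (metis card_image card_mono)
    then have "(m + 1) div 2 \<le> card B" using half by (simp flip: J_def)
    moreover have "kappa G (\<Union>Q) = int (card B)" unfolding kappa_def B_def ..
    ultimately show ?thesis using Q by auto
  qed
  then have "int ((m + 1) div 2) \<le> vertex_brittleness k G"
    unfolding vertex_brittleness_def using brittleness_ge[OF finE k] by blast
  then show ?thesis by linarith
qed

section \<open>Edge sets linked outside a set of vertices\<close>

definition share :: "'a set \<Rightarrow> 'a set set \<Rightarrow> 'a set rel" where
  "share X F = {(e, f). e \<in> F \<and> f \<in> F \<and> \<not> e \<inter> f \<subseteq> X}"

text \<open>
  Connectedness of the graph formed by the edges in \<open>F\<close> when walks may not turn at a vertex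
  of \<open>X\<close>. Compared with connectedness in terms of vertices, this notion treats edges that end
  in \<open>X\<close> like all others, and it is inherited when \<open>X\<close> shrinks.
\<close>

definition linked :: "'a set \<Rightarrow> 'a set set \<Rightarrow> bool" where
  "linked X F \<longleftrightarrow> (\<forall>e\<in>F. \<forall>f\<in>F. (e, f) \<in> (share X F)\<^sup>*)"

lemma share_mono: "X' \<subseteq> X \<Longrightarrow> F \<subseteq> F' \<Longrightarrow> share X F \<subseteq> share X' F'"
  by (auto simp: share_def)

lemma linked_antimono: "linked X F \<Longrightarrow> X' \<subseteq> X \<Longrightarrow> linked X' F"
  unfolding linked_def using rtrancl_mono[OF share_mono[of X' X F F]] by blast

lemma sym_share_rtrancl: "sym ((share X F)\<^sup>*)"
  by (intro sym_rtrancl) (auto simp: sym_def share_def Int_commute)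

lemma linked_insert:
  assumes "linked X F" "f \<in> F" "\<not> e \<inter> f \<subseteq> X"
  shows "linked X (insert e F)"
proof -
  let ?R = "(share X (insert e F))\<^sup>*"
  have old: "(g, h) \<in> ?R" if "g \<in> F" "h \<in> F" for g h
    using assms(1) that rtrancl_mono[OF share_mono[of X X F "insert e F"]]
    unfolding linked_def by blast
  have "(e, f) \<in> ?R" using assms(2,3) by (intro r_into_rtrancl) (auto simp: share_def)
  then have out_e: "(e, g) \<in> ?R" if "g \<in> F" for g
    using old[OF assms(2) that] by (rule rtrancl_trans)
  then have into_e: "(g, e) \<in> ?R" if "g \<in> F" for g
    using that symD[OF sym_share_rtrancl] by metis
  show ?thesis unfolding linked_def using old out_e into_e by blast
qed

text \<open>
  An edge with both ends in \<open>X\<close> shares no vertex outside \<open>X\<close> with any edge, not even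
  with itself, so it is isolated. This is where independence of \<open>A\<close> comes from.
\<close>

lemma linked_edge_leaves:
  assumes "linked X F" "e \<in> F" "f \<in> F" "e \<noteq> f"
  shows "\<not> e \<subseteq> X"
proof
  assume "e \<subseteq> X"
  have "(e, f) \<in> (share X F)\<^sup>*" using assms by (simp add: linked_def)
  then show False using assms(4) \<open>e \<subseteq> X\<close>
    by (cases rule: converse_rtranclE) (auto simp: share_def)
qed

text \<open>
  A connected set of edges contains connected sets of every smaller size: as long as \<open>F\<close> is
  not the whole class of \<open>e\<close>, some edge of the class outside \<open>F\<close> is adjacent to \<open>F\<close>.
\<close>

lemma linked_subset_of_card:
  assumes "1 \<le> n" and "n \<le> card ((share X E)\<^sup>* `` {e})"
  shows "\<exists>F\<subseteq>(share X E)\<^sup>* `` {e}. e \<in> F \<and> card F = n \<and> linked X F"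
  using assms
proof (induction n rule: dec_induct)
  case base
  show ?case by (intro exI[of _ "{e}"]) (auto simp: linked_def)
next
  case (step n)
  let ?K = "(share X E)\<^sup>* `` {e}"
  obtain F where F: "F \<subseteq> ?K" "e \<in> F" "card F = n" "linked X F" using step by auto
  have "\<exists>f\<in>F. \<exists>g\<in>?K - F. (f, g) \<in> share X E"
  proof (rule ccontr)
    assume no: "\<not> ?thesis"
    have "g \<in> F" if "(e, g) \<in> (share X E)\<^sup>*" for g
      using that
    proof (induction rule: rtrancl_induct)
      case base
      then show ?case by (rule F)
    next
      case (step f g)
      then show ?case using no by (meson DiffI Image_singleton_iff rtrancl.rtrancl_into_rtrancl)
    qed
    then have "?K = F" using F(1) by auto
    then show False using step F(3) by simp
  qed
  then obtain f g where fg: "f \<in> F" "g \<in> ?K - F" "(f, g) \<in> share X E" by blast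
  have "finite F" using F(3) step.hyps by (metis card.infinite not_one_le_zero)
  moreover have "linked X (insert g F)"
    using fg F(4) by (intro linked_insert[of X F f]) (auto simp: share_def Int_commute)
  ultimately show ?case using F fg by (intro exI[of _ "insert g F"]) auto
qed

text \<open>
  Two consecutive edges of a chain in \<open>F\<close> meet outside \<open>X\<close>, and an edge with two ends
  outside \<open>X\<close> survives the deletion of \<open>X\<close>; so the chain contains a walk avoiding
  \<open>X\<close>.
\<close>

lemma connected_of_linked:
  assumes "linked X F" and "\<And>e. e \<in> F \<Longrightarrow> card e = 2" and "e0 \<in> F" "f0 \<in> F" "e0 \<noteq> f0"
  shows "graph_connected (Graph (\<Union>F - X) {e\<in>F. e \<inter> X = {}})"
proof -
  let ?R = "{(x, y). {x, y} \<in> {e\<in>F. e \<inter> X = {}}}"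
  have within: "(x, y) \<in> ?R\<^sup>*" if e: "e \<in> F" "x \<in> e - X" "y \<in> e - X" for e x y
  proof (cases "x = y")
    case False
    then have "e = {x, y}"
      using e assms(2)[OF e(1)] by (auto simp: card_2_iff)
    then show ?thesis using e by (intro r_into_rtrancl) auto
  qed simp
  have "(u, v) \<in> ?R\<^sup>*" if u: "u \<in> e - X" "e \<in> F" and "v \<in> f - X" "f \<in> F" for u v e f
  proof -
    have "(e, f) \<in> (share X F)\<^sup>*" using assms(1) that by (simp add: linked_def)
    then have "\<forall>w\<in>f - X. (u, w) \<in> ?R\<^sup>*"
    proof (induction rule: rtrancl_induct)
      case base
      then show ?case using within u by blast
    next
      case (step g h)
      then obtain x where x: "x \<in> g - X" "x \<in> h - X" "h \<in> F" by (auto simp: share_def)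
      show ?case
      proof
        fix w assume "w \<in> h - X"
        then have "(x, w) \<in> ?R\<^sup>*" using within x by blast
        moreover have "(u, x) \<in> ?R\<^sup>*" using step.IH x by blast
        ultimately show "(u, w) \<in> ?R\<^sup>*" by (meson rtrancl_trans)
      qed
    qed
    then show ?thesis using that by blast
  qed
  moreover have "\<Union>F - X \<noteq> {}"
    using linked_edge_leaves[OF assms(1,3,4,5)] assms(3) by blast
  ultimately show ?thesis unfolding graph_connected_def by (simp) blast
qed

text \<open>
  Both connectivity requirements on a pair \<open>(H, A)\<close>, independence and \<open>A \<noteq> V(H)\<close> are
  consequences of the one condition that the edges of \<open>H\<close> are linked outside \<open>A\<close>.
\<close>

lemma valid_pair_of_linked:
  assumes "simple_graph H" and "linked A (edges H)" and "verts H = \<Union>(edges H)"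
    and "A \<subseteq> verts H" and "card (edges H) \<ge> 2"
  shows "graph_connected H" "independent_in H A" "A \<subset> verts H" "graph_connected (delete_verts H A)"
proof -
  have two: "card e = 2" if "e \<in> edges H" for e using assms(1) that by (simp add: simple_graph_def)
  have "\<exists>e f. e \<in> edges H \<and> f \<in> edges H \<and> e \<noteq> f"
  proof -
    have "\<not> edges H \<subseteq> {e}" for e
    proof
      assume "edges H \<subseteq> {e}"
      from card_mono[OF _ this] show False using assms(5) by simp
    qed
    then show ?thesis by (metis insertI1 subsetI)
  qed
  then obtain e f where ef: "e \<in> edges H" "f \<in> edges H" "e \<noteq> f" by blast
  have "graph_connected (Graph (\<Union>(edges H) - {}) {e\<in>edges H. e \<inter> {} = {}})"
    using linked_antimono[OF assms(2), of "{}"] two ef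
    by (intro connected_of_linked[of _ _ e f]) auto
  then show "graph_connected H" using assms(3) by (cases H) auto
  show del: "graph_connected (delete_verts H A)"
    unfolding delete_verts_def assms(3) using assms(2) two ef
    by (intro connected_of_linked[of _ _ e f]) auto
  have leaves: "\<not> g \<subseteq> A" if "g \<in> edges H" for g
    using linked_edge_leaves[OF assms(2) that] ef that by metis
  then show "independent_in H A"
    using assms(4) unfolding independent_in_def by blast
  show "A \<subset> verts H" using leaves[OF ef(1)] assms(3,4) ef(1) by blast
qed

lemma linked_image:
  assumes "inj_on g V" and "S \<subseteq> V" and "E \<subseteq> Pow V" and "linked (g ` S) ((`) g ` E)"
  shows "linked S E"
  unfolding linked_def
proof (intro ballI)
  fix e f assume e: "e \<in> E" and f: "f \<in> E"
  have reach: "\<exists>f'\<in>E. d = g ` f' \<and> (e, f') \<in> (share S E)\<^sup>*"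
    if "(g ` e, d) \<in> (share (g ` S) ((`) g ` E))\<^sup>*" for d
    using that
  proof (induction rule: rtrancl_induct)
    case base
    then show ?case using e by blast
  next
    case (step d d')
    then obtain f' where f': "f' \<in> E" "d = g ` f'" "(e, f') \<in> (share S E)\<^sup>*" by blast
    obtain f'' where f'': "f'' \<in> E" "d' = g ` f''" "\<not> g ` f' \<inter> g ` f'' \<subseteq> g ` S"
      using step.hyps(2) f'(2) by (auto simp: share_def)
    obtain z where "z \<in> g ` f'" "z \<in> g ` f''" "z \<notin> g ` S" using f''(3) by blast
    then obtain x y where xy: "x \<in> f'" "y \<in> f''" "g x = g y" "g x \<notin> g ` S" by (metis imageE)
    then have "x = y" using assms(1,3) f' f'' by (meson PowD inj_onD subsetD)
    then have "(f', f'') \<in> share S E" using xy f'(1) f''(1) by (auto simp: share_def)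
    with f'(3) have "(e, f'') \<in> (share S E)\<^sup>*" by (rule rtrancl_into_rtrancl)
    then show ?case using f''(1,2) by blast
  qed
  have "(g ` e, g ` f) \<in> (share (g ` S) ((`) g ` E))\<^sup>*"
    using assms(4) e f by (simp add: linked_def)
  then obtain f' where "f' \<in> E" "g ` f = g ` f'" "(e, f') \<in> (share S E)\<^sup>*"
    using reach by blast
  moreover then have "f' = f"
    using assms(1,3) f by (metis PowD inj_on_image_eq_iff subsetD)
  ultimately show "(e, f) \<in> (share S E)\<^sup>*" by simp
qed

section \<open>Brittle graphs contain many linked edge sets\<close>

text \<open>
  Partition the edges into classes, where edges that share a vertex outside \<open>X\<close> are equivalent.
  A vertex outside \<open>X\<close> has all its edges in one class, so only vertices of \<open>X\<close> can be cut
  by a union of classes. Hence this partition would bound the brittleness by \<open>card X\<close> if all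
  classes were small.
\<close>

lemma large_class_of_brittle:
  fixes G :: "'a graph"
  assumes G: "simple_graph G" and X: "finite X" and large: "vertex_brittleness k G > int (card X)"
  shows "\<exists>e\<in>edges G. k < card ((share X (edges G))\<^sup>* `` {e})"
proof (rule ccontr)
  assume no: "\<not> ?thesis"
  define E where "E = edges G"
  define r where "r = (share X E)\<^sup>* \<inter> E \<times> E"
  have finE: "finite E" unfolding E_def using G by (rule finite_edges)
  have stays: "f \<in> E" if "(e, f) \<in> (share X E)\<^sup>*" "e \<in> E" for e f
    using that by (induction rule: rtrancl_induct) (auto simp: share_def)
  have cls: "r `` {e} = (share X E)\<^sup>* `` {e}" if "e \<in> E" for e
    using that stays by (auto simp: r_def)
  have equiv: "equiv E r"
  proof (rule equivI)
    show "r \<subseteq> E \<times> E" by (auto simp: r_def)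
    show "refl_on E r" by (auto simp: refl_on_def r_def)
    show "sym r" using sym_share_rtrancl[of X E] by (auto simp: sym_def r_def)
    show "trans r" by (auto simp: trans_def r_def)
  qed
  have "vertex_brittleness k G \<le> int (card X)"
    unfolding vertex_brittleness_def
  proof (rule brittleness_le)
    show "finite (edges G)" using finE by (simp add: E_def)
    show "partition_on (edges G) (E // r)"
      using equiv unfolding E_def[symmetric] by (rule partition_on_quotient)
    show "card p \<le> k" if "p \<in> E // r" for p
      using that no cls by (auto simp: quotient_def E_def not_less)
  next
    fix Q assume Q: "Q \<subseteq> E // r"
    have "{v \<in> verts G. (\<exists>e\<in>\<Union>Q. v \<in> e) \<and> (\<exists>e\<in>edges G - \<Union>Q. v \<in> e)} \<subseteq> X"
    proof (clarify, rule ccontr)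
      fix v e f p
      assume v: "p \<in> Q" "e \<in> p" "v \<in> e" "f \<in> edges G" "f \<notin> \<Union>Q" "v \<in> f" "v \<notin> X"
      have "p \<in> E // r" using Q v by blast
      then have "e \<in> E" using v equiv by (meson in_quotient_imp_subset subsetD)
      then have "(e, f) \<in> r"
        using v by (auto simp: r_def E_def share_def)
      then have "f \<in> p" using \<open>p \<in> E // r\<close> v equiv by (meson in_quotient_imp_closed)
      then show False using v by blast
    qed
    then show "kappa G (\<Union>Q) \<le> int (card X)"
      unfolding kappa_def using X by (simp add: card_mono)
  qed
  then show False using large by simp
qed

lemma card_Union_le:
  assumes "\<And>e. e \<in> F \<Longrightarrow> card e = 2"
  shows "card (\<Union>F) \<le> 2 * card F"
proof -
  have "card (\<Union>F) \<le> (\<Sum>e\<in>F. card e)"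
    by (metis card_Union_le_sum_card)
  also have "\<dots> = 2 * card F" using assms by simp
  finally show ?thesis .
qed

text \<open>
  A greedy choice: with \<open>X\<close> the set of all vertices used before, \<open>large_class_of_brittle\<close>
  yields the next connected set of \<open>k + 1\<close> edges. Each step adds at most \<open>2 * (k + 1)\<close>
  vertices to \<open>X\<close>, which is where the bound on the brittleness comes from.
\<close>

lemma linked_sequence_of_brittle:
  assumes G: "simple_graph G" and k: "k \<ge> 1"
    and large: "vertex_brittleness k G > int (N * (2 * (k + 1)))"
  shows "\<exists>F. \<forall>j<N. F j \<subseteq> edges G \<and> card (F j) = k + 1 \<and> linked (\<Union>i<j. \<Union>(F i)) (F j)"
  using large
proof (induction N)
  case 0
  then show ?case by simp
next
  case (Suc N)
  then obtain F where F: "\<And>j. j < N \<Longrightarrow> F j \<subseteq> edges G \<and> card (F j) = k + 1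
      \<and> linked (\<Union>i<j. \<Union>(F i)) (F j)"
    by fastforce
  define X where "X = (\<Union>i<N. \<Union>(F i))"
  have two: "card e = 2" if "e \<in> edges G" for e using G that by (simp add: simple_graph_def)
  have "card (\<Union>(F i)) \<le> 2 * (k + 1)" if "i < N" for i
  proof -
    have "card (\<Union>(F i)) \<le> 2 * card (F i)" using F[OF that] two by (intro card_Union_le) blast
    then show ?thesis using F[OF that] by simp
  qed
  then have "(\<Sum>i<N. card (\<Union>(F i))) \<le> N * (2 * (k + 1))"
    using sum_bounded_above[of "{..<N}" "\<lambda>i. card (\<Union>(F i))" "2 * (k + 1)"] by simp
  moreover have "card X \<le> (\<Sum>i<N. card (\<Union>(F i)))"
    unfolding X_def by (rule card_UN_le) simp
  ultimately have "card X \<le> N * (2 * (k + 1))" by linarith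
  also have "\<dots> \<le> Suc N * (2 * (k + 1))" by simp
  finally have "int (card X) \<le> int (Suc N * (2 * (k + 1)))" unfolding of_nat_le_iff .
  then have "vertex_brittleness k G > int (card X)" using Suc.prems by linarith
  moreover have "finite X"
  proof (rule finite_subset)
    show "X \<subseteq> verts G"
    proof
      fix v assume "v \<in> X"
      then obtain i e where "i < N" "e \<in> F i" "v \<in> e" by (auto simp: X_def)
      then show "v \<in> verts G" using F[of i] G unfolding simple_graph_def by blast
    qed
  qed (use G in \<open>simp add: simple_graph_def\<close>)
  ultimately obtain e where e: "e \<in> edges G" "k < card ((share X (edges G))\<^sup>* `` {e})"
    using large_class_of_brittle[OF G] by blast
  obtain F' where F': "F' \<subseteq> (share X (edges G))\<^sup>* `` {e}" "card F' = k + 1" "linked X F'"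
    using linked_subset_of_card[of "k + 1" X "edges G" e] e(2) by auto
  have "f \<in> edges G" if "(e, f) \<in> (share X (edges G))\<^sup>*" for f
    using that e(1) by (induction rule: rtrancl_induct) (auto simp: share_def)
  then have "F' \<subseteq> edges G" using F'(1) by auto
  then show ?case
    using F F' unfolding X_def
    by (intro exI[of _ "F(N := F')"]) (auto simp: less_Suc_eq)
qed

section \<open>Sunflowers of linked edge sets\<close>

text \<open>
  Ramsey's theorem for pairs, for an arbitrary finite set of colours and with the
  homogeneous set listed in increasing order.
\<close>

lemma ramsey_pairs:
  fixes M :: nat
  assumes "finite K"
  shows "\<exists>N::nat. \<forall>\<chi>. (\<forall>j<N. \<forall>i<j. \<chi> i j \<in> K) \<longrightarrow>
    (\<exists>r c. strict_mono_on {..<M} r \<and> (\<forall>i<M. r i < N) \<and> (\<forall>j<M. \<forall>i<j. \<chi> (r i) (r j) = c))"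
proof -
  obtain g where g: "bij_betw g K {0..<card K}"
    using ex_bij_betw_finite_nat[OF assms] by blast
  obtain N :: nat where N: "partn_lst {..<N} (replicate (card K) M) 2"
    using ramsey_full by blast
  have "\<exists>r c. strict_mono_on {..<M} r \<and> (\<forall>i<M. r i < N) \<and> (\<forall>j<M. \<forall>i<j. \<chi> (r i) (r j) = c)"
    if \<chi>: "\<forall>j<N. \<forall>i<j. \<chi> i j \<in> K" for \<chi>
  proof -
    define col where "col s = g (\<chi> (Min s) (Max s))" for s
    have col_pair: "col {i, j} = g (\<chi> i j)" if "i < j" for i j
      using that by (simp add: col_def)
    have "col \<in> [{..<N}]\<^bsup>2\<^esup> \<rightarrow> {..<length (replicate (card K) M)}"
    proof
      fix s assume "s \<in> [{..<N}]\<^bsup>2\<^esup>"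
      then obtain i j where ij: "s = {i, j}" "i < j" "j < N"
        by (fastforce simp: ordered_nsets_2_eq)
      then have "\<chi> i j \<in> K" using \<chi> by blast
      then have "g (\<chi> i j) \<in> {0..<card K}" using g by (metis bij_betwE)
      then show "col s \<in> {..<length (replicate (card K) M)}"
        using ij col_pair by simp
    qed
    then obtain q where q: "q < card K" "monochromatic {..<N} M 2 col q"
      using N unfolding partn_lst_def by auto
    then obtain J where J: "J \<in> [{..<N}]\<^bsup>M\<^esup>" "col ` [J]\<^bsup>2\<^esup> \<subseteq> {q}"
      unfolding monochromatic_def by blast
    then have J': "J \<subseteq> {..<N}" "finite J" "card J = M" by (auto simp: nsets_def)
    then obtain r where r: "strict_mono_on {..<M} r" "\<forall>i<M. r i \<in> J"
      using finite_enumerate[of J] by auto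
    have less: "r i < r j" if "i < j" "j < M" for i j
      using r(1) that by (auto simp: strict_mono_on_def)
    have "\<chi> (r i) (r j) = inv_into K g q" if ij: "i < j" "j < M" for i j
    proof -
      have "{r i, r j} \<in> [J]\<^bsup>2\<^esup>" using less[OF ij] r(2) ij by auto
      then have "g (\<chi> (r i) (r j)) = q"
        using J(2) col_pair[OF less[OF ij]] by fastforce
      moreover have "\<chi> (r i) (r j) \<in> K"
        using \<chi> less[OF ij] r(2) ij J'(1) by (meson lessThan_iff subsetD)
      ultimately show ?thesis using g by (metis bij_betw_inv_into_left)
    qed
    then show ?thesis using r J'(1) by (intro exI[of _ r] exI[of _ "inv_into K g q"]) auto
  qed
  then show ?thesis by blast
qed

text \<open>
  A labelled form of the sunflower lemma. Number the vertices of each \<open>F j\<close>, so that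
  \<open>F j\<close> becomes an edge set on \<open>{..<n}\<close>, and colour a pair \<open>i < j\<close> by both of these
  edge sets and by the relation telling which numbers denote the same vertex in \<open>F i\<close> and
  \<open>F j\<close>. On a homogeneous set, all \<open>F j\<close> look alike and any two meet in the same
  relation, which injectivity forces to be a partial identity; \<open>S\<close> is its domain, the kernel.
  The first member of the sunflower contains the kernel, so for the second member the kernel
  consists of vertices used earlier. Therefore linkedness of the second member outside the earlier
  vertices implies linkedness outside the kernel.
\<close>

lemma sunflower_of_linked_sequence:
  fixes k M :: nat
  shows "\<exists>N. \<forall>F :: nat \<Rightarrow> 'a set set.
    (\<forall>j<N. (\<forall>e\<in>F j. card e = 2) \<and> card (F j) = k + 1 \<and> linked (\<Union>i<j. \<Union>(F i)) (F j)) \<longrightarrow>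
    (\<exists>n E S \<phi>. n \<le> 2 * (k + 1) \<and> \<Union>E = {..<n} \<and> S \<subseteq> {..<n} \<and> (\<forall>e\<in>E. card e = 2)
      \<and> card E = k + 1 \<and> linked S E
      \<and> (\<forall>i<M. inj_on (\<phi> i) {..<n} \<and> (\<exists>j<N. (`) (\<phi> i) ` E = F j))
      \<and> (\<forall>i<M. \<forall>j<M. i \<noteq> j \<longrightarrow> (\<forall>s<n. \<forall>t<n. \<phi> i s = \<phi> j t \<longleftrightarrow> s = t \<and> s \<in> S)))"
proof -
  define L where "L = 2 * (k + 1)"
  define T where "T = {..L} \<times> Pow (Pow {..<L})"
  have "finite (T \<times> T \<times> Pow ({..<L} \<times> {..<L}))" by (simp add: T_def)
  \<comment> \<open>Three members of the homogeneous set are needed to see that all members have the same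
    shape and that the relation is diagonal, even if \<open>M\<close> is smaller.\<close>
  from ramsey_pairs[OF this, of "M + 3"] obtain N :: nat where N:
    "\<forall>\<chi>. (\<forall>j<N. \<forall>i<j. \<chi> i j \<in> T \<times> T \<times> Pow ({..<L} \<times> {..<L})) \<longrightarrow>
      (\<exists>r c. strict_mono_on {..<M + 3} r \<and> (\<forall>i<M + 3. r i < N)
        \<and> (\<forall>j<M + 3. \<forall>i<j. \<chi> (r i) (r j) = c))"
    by (rule exE) (rule that)
  show ?thesis
  proof (rule exI[of _ N], intro allI impI)
    fix F :: "nat \<Rightarrow> 'a set set"
    assume "\<forall>j<N. (\<forall>e\<in>F j. card e = 2) \<and> card (F j) = k + 1 \<and> linked (\<Union>i<j. \<Union>(F i)) (F j)"
    then have two: "\<And>j e. j < N \<Longrightarrow> e \<in> F j \<Longrightarrow> card e = 2"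
      and cardF: "\<And>j. j < N \<Longrightarrow> card (F j) = k + 1"
      and linkF: "\<And>j. j < N \<Longrightarrow> linked (\<Union>i<j. \<Union>(F i)) (F j)"
      by blast+
    define nn where "nn j = card (\<Union>(F j))" for j
    have "\<exists>\<psi>. bij_betw \<psi> {..<nn j} (\<Union>(F j))" if "j < N" for j
    proof -
      have "finite (F j)" using cardF[OF that]
        by (metis add_eq_0_iff_both_eq_0 card.infinite one_neq_zero)
      moreover have "finite e" if "e \<in> F j" for e
        using two[OF \<open>j < N\<close> that] by (metis card.infinite zero_neq_numeral)
      ultimately have "finite (\<Union>(F j))" by blast
      then show ?thesis unfolding nn_def using ex_bij_betw_nat_finite by (metis atLeast0LessThan)
    qed
    then obtain \<psi> where \<psi>: "\<And>j. j < N \<Longrightarrow> bij_betw (\<psi> j) {..<nn j} (\<Union>(F j))" by metis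
    define EE where "EE j = {e. e \<subseteq> {..<nn j} \<and> \<psi> j ` e \<in> F j}" for j
    have nn_le: "nn j \<le> L" if "j < N" for j
      unfolding nn_def L_def using card_Union_le[of "F j"] two[OF that] cardF[OF that] by simp
    have imgE: "(`) (\<psi> j) ` EE j = F j" if "j < N" for j
    proof
      show "F j \<subseteq> (`) (\<psi> j) ` EE j"
      proof
        fix f assume f: "f \<in> F j"
        then have "f \<subseteq> \<psi> j ` {..<nn j}" using \<psi>[OF that] by (auto simp: bij_betw_def)
        then obtain e where "e \<subseteq> {..<nn j}" "f = \<psi> j ` e" by (meson subset_imageE)
        then show "f \<in> (`) (\<psi> j) ` EE j" using f by (auto simp: EE_def)
      qed
    qed (auto simp: EE_def)
    define \<chi> where "\<chi> i j = ((nn i, EE i), (nn j, EE j),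
      {(s, t). s < nn i \<and> t < nn j \<and> \<psi> i s = \<psi> j t})" for i j
    have "\<forall>j<N. \<forall>i<j. \<chi> i j \<in> T \<times> T \<times> Pow ({..<L} \<times> {..<L})"
    proof (intro allI impI)
      fix i j :: nat assume ij: "j < N" "i < j"
      have "(nn a, EE a) \<in> T" if "a < N" for a
        using nn_le[OF that] by (auto simp: T_def EE_def)
      moreover have "{(s, t). s < nn i \<and> t < nn j \<and> \<psi> i s = \<psi> j t} \<subseteq> {..<L} \<times> {..<L}"
        using nn_le[of i] nn_le[of j] ij by auto
      ultimately show "\<chi> i j \<in> T \<times> T \<times> Pow ({..<L} \<times> {..<L})"
        using ij by (simp add: \<chi>_def)
    qed
    from N[THEN spec, THEN mp, OF this] obtain r c where r: "strict_mono_on {..<M + 3} r" "\<And>i. i < M + 3 \<Longrightarrow> r i < N"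
      and "\<forall>j<M + 3. \<forall>i<j. \<chi> (r i) (r j) = c"
      by blast
    then have c: "\<And>i j. i < j \<Longrightarrow> j < M + 3 \<Longrightarrow> \<chi> (r i) (r j) = c" by blast
    define n where "n = nn (r 1)"
    define E where "E = EE (r 1)"
    define R where "R = snd (snd c)"
    \<comment> \<open>The member with index 1 is the larger one in the pair \<open>0 < 1\<close> and the smaller one
      in \<open>1 < 2\<close>, so both components of the common colour are its shape.\<close>
    have type1: "(nn (r 1), EE (r 1)) = fst c"
      using c[of 1 2] by (auto simp: \<chi>_def)
    have type2: "(nn (r 1), EE (r 1)) = fst (snd c)"
      using c[of 0 1] by (auto simp: \<chi>_def)
    have same: "nn (r i) = n \<and> EE (r i) = E" if "i < M + 3" for i
    proof (cases "i = 0")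
      case True
      then have "(nn (r i), EE (r i)) = fst c" using c[of 0 1] by (auto simp: \<chi>_def)
      then show ?thesis using type1 unfolding n_def E_def by (metis Pair_inject)
    next
      case False
      then have "(nn (r i), EE (r i)) = fst (snd c)" using c[of 0 i] that by (auto simp: \<chi>_def)
      then show ?thesis using type2 unfolding n_def E_def by (metis Pair_inject)
    qed
    define \<phi> where "\<phi> i = \<psi> (r i)" for i
    have bij: "bij_betw (\<phi> i) {..<n} (\<Union>(F (r i)))" if "i < M + 3" for i
      using \<psi>[OF r(2)[OF that]] same[OF that] by (simp add: \<phi>_def)
    have img: "(`) (\<phi> i) ` E = F (r i)" if "i < M + 3" for i
      using imgE[OF r(2)[OF that]] same[OF that] by (simp add: \<phi>_def)
    have R: "(s, t) \<in> R \<longleftrightarrow> s < n \<and> t < n \<and> \<phi> i s = \<phi> j t" if ij: "i < j" "j < M + 3" for i j s t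
    proof -
      have "R = snd (snd (\<chi> (r i) (r j)))" using c[OF ij] by (simp add: R_def)
      then show ?thesis using same[of i] same[of j] ij by (simp add: \<chi>_def \<phi>_def)
    qed
    \<comment> \<open>The vertices \<open>\<phi> 0 s\<close>, \<open>\<phi> 1 s\<close>, \<open>\<phi> 1 t\<close> and \<open>\<phi> 2 t\<close> all coincide.\<close>
    have diagonal: "s = t" if "(s, t) \<in> R" for s t
    proof -
      have "\<phi> 0 s = \<phi> 2 t" "\<phi> 1 s = \<phi> 2 t" "\<phi> 0 s = \<phi> 1 t" "s < n" "t < n"
        using that R[of 0 2 s t] R[of 1 2 s t] R[of 0 1 s t] by auto
      moreover have "inj_on (\<phi> 1) {..<n}" using bij[of 1] by (simp add: bij_betw_def)
      ultimately show ?thesis by (metis inj_onD lessThan_iff)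
    qed
    define S where "S = {s. (s, s) \<in> R}"
    have Sn: "S \<subseteq> {..<n}" using R[of 0 1] by (auto simp: S_def)
    have meet: "\<phi> i s = \<phi> j t \<longleftrightarrow> s = t \<and> s \<in> S"
      if "i < M + 3" "j < M + 3" "i \<noteq> j" "s < n" "t < n" for i j s t
    proof (cases "i < j")
      case True
      then show ?thesis using R[OF True that(2), of s t] diagonal[of s t] that by (auto simp: S_def)
    next
      case False
      then have "j < i" using that by simp
      then show ?thesis using R[OF \<open>j < i\<close> that(1), of t s] diagonal[of t s] that
        by (auto simp: S_def)
    qed
    have E_sub: "E \<subseteq> Pow {..<n}" by (auto simp: E_def n_def EE_def)
    have inj1: "inj_on (\<phi> 1) {..<n}" using bij[of 1] by (simp add: bij_betw_def)
    have E1: "(`) (\<phi> 1) ` E = F (r 1)" by (rule img) simp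
    have "r 1 < N" by (rule r) simp
    have inj_img: "inj_on ((`) (\<phi> 1)) E"
      using inj_on_image_Pow[OF inj1] E_sub by (rule inj_on_subset)
    have "\<Union>E = {..<n}"
    proof -
      have "\<phi> 1 ` \<Union>E = \<Union>(F (r 1))" using E1 by blast
      also have "\<dots> = \<phi> 1 ` {..<n}" using bij[of 1] by (simp add: bij_betw_def)
      finally show ?thesis using inj1 E_sub
        by (metis Sup_le_iff PowD inj_on_image_eq_iff order_refl subsetD)
    qed
    moreover have "card e = 2" if "e \<in> E" for e
    proof -
      have "card (\<phi> 1 ` e) = 2" using two[OF \<open>r 1 < N\<close>] E1 that by blast
      moreover have "inj_on (\<phi> 1) e" using inj1 E_sub that by (meson PowD inj_on_subset subsetD)
      ultimately show ?thesis by (simp add: card_image)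
    qed
    moreover have "card E = k + 1"
      using cardF[OF \<open>r 1 < N\<close>] card_image[OF inj_img] E1 by simp
    moreover have "linked S E"
    proof (rule linked_image[OF inj1 Sn E_sub])
      have "r 0 < r 1" using r(1) by (auto simp: strict_mono_on_def)
      moreover have "\<phi> 1 ` S \<subseteq> \<Union>(F (r 0))"
      proof
        fix x assume "x \<in> \<phi> 1 ` S"
        then obtain s where s: "s \<in> S" "x = \<phi> 1 s" by blast
        then have "s < n" "\<phi> 0 s = \<phi> 1 s" using R[of 0 1 s s] by (auto simp: S_def)
        then show "x \<in> \<Union>(F (r 0))" using s bij[of 0]
          by (metis bij_betwE lessThan_iff add_gr_0 zero_less_numeral)
      qed
      ultimately have "\<phi> 1 ` S \<subseteq> (\<Union>i<r 1. \<Union>(F i))" by blast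
      then show "linked (\<phi> 1 ` S) ((`) (\<phi> 1) ` E)"
        unfolding E1 using linkF[OF \<open>r 1 < N\<close>] linked_antimono by blast
    qed
    moreover have "n \<le> 2 * (k + 1)" using nn_le[OF \<open>r 1 < N\<close>] by (simp add: n_def L_def)
    moreover have "\<forall>i<M. inj_on (\<phi> i) {..<n} \<and> (\<exists>j<N. (`) (\<phi> i) ` E = F j)"
      using bij img r(2) by (meson bij_betw_def trans_less_add1)
    moreover have "\<forall>i<M. \<forall>j<M. i \<noteq> j \<longrightarrow> (\<forall>s<n. \<forall>t<n. \<phi> i s = \<phi> j t \<longleftrightarrow> s = t \<and> s \<in> S)"
      using meet by auto
    ultimately show "\<exists>n E S \<phi>. n \<le> 2 * (k + 1) \<and> \<Union>E = {..<n} \<and> S \<subseteq> {..<n} \<and> (\<forall>e\<in>E. card e = 2)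
      \<and> card E = k + 1 \<and> linked S E
      \<and> (\<forall>i<M. inj_on (\<phi> i) {..<n} \<and> (\<exists>j<N. (`) (\<phi> i) ` E = F j))
      \<and> (\<forall>i<M. \<forall>j<M. i \<noteq> j \<longrightarrow> (\<forall>s<n. \<forall>t<n. \<phi> i s = \<phi> j t \<longleftrightarrow> s = t \<and> s \<in> S))"
      using Sn by blast
  qed
qed

text \<open>
  A sunflower of copies of \<open>H\<close> in \<open>G\<close>, with kernel labelled by \<open>S\<close>, is the same as
  a copy of \<open>mH/S\<close> in \<open>G\<close>.
\<close>

lemma glued_copies_in_class:
  fixes C :: "'b graph set" and H :: "'a graph"
  assumes C: "subgraph_ideal C" "G \<in> C" and S: "S \<subseteq> verts H"
    and inj: "\<And>i. i < m \<Longrightarrow> inj_on (\<phi> i) (verts H)"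
    and verts: "\<And>i. i < m \<Longrightarrow> \<phi> i ` verts H \<subseteq> verts G"
    and edges: "\<And>i. i < m \<Longrightarrow> (`) (\<phi> i) ` edges H \<subseteq> edges G"
    and H: "simple_graph H"
    and meet: "\<And>i j s t. i < m \<Longrightarrow> j < m \<Longrightarrow> i \<noteq> j \<Longrightarrow> s \<in> verts H \<Longrightarrow> t \<in> verts H
      \<Longrightarrow> \<phi> i s = \<phi> j t \<longleftrightarrow> s = t \<and> s \<in> S"
  shows "in_class (glued_copies m H S) C"
proof -
  define f where "f = (\<lambda>(v, i). \<phi> i v)"
  have f: "f (glue S i v) = \<phi> i v" if "i < m" "v \<in> verts H" for i v
  proof (cases "v \<in> S \<and> i \<noteq> 0")
    case True
    then have "\<phi> 0 v = \<phi> i v" using meet[of 0 i v v] that by auto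
    then show ?thesis using True by (simp add: f_def glue_def)
  qed (auto simp: f_def glue_def)
  define G' where "G' = map_verts f (glued_copies m H S)"
  have vG': "verts G' = (\<Union>i<m. \<phi> i ` verts H)"
    using f by (auto simp: G'_def map_verts_def verts_glued_copies image_UN image_image)
  have fe: "f ` glue S i ` e = \<phi> i ` e" if "i < m" "e \<in> edges H" for i e
  proof -
    have "e \<subseteq> verts H" using H that by (simp add: simple_graph_def)
    then show ?thesis using f that(1) unfolding image_image by (intro image_cong) auto
  qed
  have eG': "edges G' = (\<Union>i<m. (`) (\<phi> i) ` edges H)"
  proof -
    have "edges G' = (\<Union>i<m. (\<lambda>e. f ` glue S i ` e) ` edges H)"
      by (simp add: G'_def map_verts_def edges_glued_copies image_UN image_image)
    also have "\<dots> = (\<Union>i<m. (`) (\<phi> i) ` edges H)"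
      using fe by (intro SUP_cong image_cong) auto
    finally show ?thesis .
  qed
  have simpleG: "simple_graph G" using C by (simp add: subgraph_ideal_def)
  have simple: "simple_graph G'"
  proof -
    have "e \<subseteq> verts G' \<and> card e = 2" if "e \<in> edges G'" for e
    proof
      show "e \<subseteq> verts G'" using that H unfolding vG' eG' simple_graph_def by fastforce
      have "e \<in> edges G" using that edges unfolding eG' by blast
      then show "card e = 2" using simpleG by (simp add: simple_graph_def)
    qed
    moreover have "finite (verts G')" using H by (simp add: vG' simple_graph_def)
    ultimately show ?thesis by (simp add: simple_graph_def)
  qed
  have "verts G' \<subseteq> verts G" unfolding vG' using verts by (intro UN_least) auto
  moreover have "edges G' \<subseteq> edges G" unfolding eG' using edges by (intro UN_least) auto
  ultimately have "subgraph_of G' G" using simple by (simp add: subgraph_of_def)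
  moreover have "graph_isomorphic G' G'"
    unfolding graph_isomorphic_def by (intro exI[of _ id]) (cases G', simp add: map_verts_def)
  ultimately have "G' \<in> C" using C simple unfolding subgraph_ideal_def by blast
  moreover have "inj_on f (verts (glued_copies m H S))"
  proof (rule inj_onI)
    fix x y
    assume "x \<in> verts (glued_copies m H S)" "y \<in> verts (glued_copies m H S)" and eq: "f x = f y"
    then obtain i v j w where *: "i < m" "v \<in> verts H" "x = glue S i v"
      "j < m" "w \<in> verts H" "y = glue S j w"
      by (auto simp: verts_glued_copies)
    then have "\<phi> i v = \<phi> j w" using eq f by simp
    then have "v = w \<and> (v \<in> S \<or> i = j)"
      using * meet[of i j v w] inj[of i] by (cases "i = j") (auto dest: inj_onD)
    then show "x = y" using * by (auto simp: glue_eq_iff)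
  qed
  ultimately show ?thesis unfolding in_class_def graph_isomorphic_def G'_def by blast
qed

section \<open>Scattered subgraph ideals\<close>

theorem theorem1p1:
  fixes k :: nat and C :: "nat graph set"
  assumes "k \<ge> 1" and "subgraph_ideal C"
  shows "vertex_scattered k C \<longleftrightarrow>
    (\<forall>(H :: nat graph) A. simple_graph H \<and> graph_connected H \<and> card (edges H) = k + 1 \<and>
        independent_in H A \<and> A \<subset> verts H \<and> graph_connected (delete_verts H A) \<longrightarrow>
      \<not> (\<forall>m\<ge>1. in_class (glued_copies m H A) C))"
    (is "_ \<longleftrightarrow> (\<forall>H A. ?valid H A \<longrightarrow> \<not> ?all H A)")
proof
  assume "vertex_scattered k C"
  then obtain b where b: "\<And>G. G \<in> C \<Longrightarrow> vertex_brittleness k G \<le> b"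
    by (auto simp: vertex_scattered_def)
  show "\<forall>H A. ?valid H A \<longrightarrow> \<not> ?all H A"
  proof (intro allI impI notI)
    fix H :: "nat graph" and A
    assume valid: "?valid H A" and all: "?all H A"
    define m where "m = nat (2 * b) + 1"
    obtain G where G: "G \<in> C" "graph_isomorphic (glued_copies m H A) G"
      using all unfolding in_class_def m_def by (meson le_add2)
    have "simple_graph G" using G(1) assms(2) by (simp add: subgraph_ideal_def)
    then have "int m \<le> 2 * vertex_brittleness k G"
      using brittleness_of_glued_copies[OF assms(1) _ _ _ _ _ G(2)] valid by blast
    then show False using b[OF G(1)] unfolding m_def by linarith
  qed
next
  assume no: "\<forall>H A. ?valid H A \<longrightarrow> \<not> ?all H A"
  define L where "L = 2 * (k + 1)"
  \<comment> \<open>A graph with \<open>k + 1\<close> edges and without isolated vertices has at most \<open>L\<close>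
    vertices, so it has a copy on an initial segment of \<open>{..<L}\<close>. This leaves finitely many pairs \<open>(H, A)\<close>, and one \<open>M\<close> such that each
    of them has some \<open>mH/A\<close> with \<open>m \<le> M\<close> outside the class.\<close>
  define D where "D = {(H, A) \<in> (\<lambda>(n, E). Graph {..<n} E) ` ({..L} \<times> Pow (Pow {..<L})) \<times> Pow {..<L}.
    ?valid H A}"
  have "finite D" unfolding D_def by (rule finite_subset[of _
      "(\<lambda>(n, E). Graph {..<n} E) ` ({..L} \<times> Pow (Pow {..<L})) \<times> Pow {..<L}"]) auto
  have "\<exists>m\<ge>1. \<not> in_class (glued_copies m H A) C" if "?valid H A" for H A
    using no that by blast
  then obtain \<mu> where \<mu>: "\<And>H A. ?valid H A \<Longrightarrow> \<mu> H A \<ge> 1 \<and> \<not> in_class (glued_copies (\<mu> H A) H A) C"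
    by metis
  obtain M where M: "\<And>H A. (H, A) \<in> D \<Longrightarrow> \<mu> H A \<le> M"
    using finite_imageI[OF \<open>finite D\<close>, of "\<lambda>(H, A). \<mu> H A"]
    unfolding finite_nat_set_iff_bounded_le by fastforce
  from sunflower_of_linked_sequence[of k M] obtain N where N: "\<forall>F :: nat \<Rightarrow> nat set set.
    (\<forall>j<N. (\<forall>e\<in>F j. card e = 2) \<and> card (F j) = k + 1 \<and> linked (\<Union>i<j. \<Union>(F i)) (F j)) \<longrightarrow>
    (\<exists>n E S \<phi>. n \<le> 2 * (k + 1) \<and> \<Union>E = {..<n} \<and> S \<subseteq> {..<n} \<and> (\<forall>e\<in>E. card e = 2)
      \<and> card E = k + 1 \<and> linked S E
      \<and> (\<forall>i<M. inj_on (\<phi> i) {..<n} \<and> (\<exists>j<N. (`) (\<phi> i) ` E = F j))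
      \<and> (\<forall>i<M. \<forall>j<M. i \<noteq> j \<longrightarrow> (\<forall>s<n. \<forall>t<n. \<phi> i s = \<phi> j t \<longleftrightarrow> s = t \<and> s \<in> S)))"
    by (rule exE) (rule that)
  have "vertex_brittleness k G \<le> int (N * L)" if G: "G \<in> C" for G
  proof (rule ccontr)
    assume large: "\<not> vertex_brittleness k G \<le> int (N * L)"
    have simple: "simple_graph G" using G assms(2) by (simp add: subgraph_ideal_def)
    obtain F where F: "\<And>j. j < N \<Longrightarrow> F j \<subseteq> edges G \<and> card (F j) = k + 1
        \<and> linked (\<Union>i<j. \<Union>(F i)) (F j)"
      using linked_sequence_of_brittle[OF simple assms(1), of N] large unfolding L_def not_le
      by blast
    have "\<forall>j<N. (\<forall>e\<in>F j. card e = 2) \<and> card (F j) = k + 1 \<and> linked (\<Union>i<j. \<Union>(F i)) (F j)"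
      using F simple unfolding simple_graph_def by blast
    from N[THEN spec, THEN mp, OF this] obtain n E S \<phi> where n: "n \<le> 2 * (k + 1)"
      and E: "\<Union>E = {..<n}" and S: "S \<subseteq> {..<n}" and E2: "\<forall>e\<in>E. card e = 2" "card E = k + 1"
      and link: "linked S E"
      and \<phi>: "\<forall>i<M. inj_on (\<phi> i) {..<n} \<and> (\<exists>j<N. (`) (\<phi> i) ` E = F j)"
      and meet: "\<forall>i<M. \<forall>j<M. i \<noteq> j \<longrightarrow> (\<forall>s<n. \<forall>t<n. \<phi> i s = \<phi> j t \<longleftrightarrow> s = t \<and> s \<in> S)"
      by (elim exE conjE) (rule that)
    define H where "H = Graph {..<n} E"
    have H: "simple_graph H" using E E2 by (auto simp: simple_graph_def H_def)
    have valid: "?valid H S"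
      using valid_pair_of_linked[OF H, of S] H S E E2 link assms(1) by (simp add: H_def)
    have "(H, S) \<in> D"
    proof -
      have nL: "n \<le> L" "{..<n} \<subseteq> {..<L}" using n by (auto simp: L_def)
      have "E \<subseteq> Pow {..<L}"
        using subset_Pow_Union[of E] Pow_mono[OF nL(2)] unfolding E by (rule order_trans)
      moreover have "S \<subseteq> {..<L}" using S nL(2) by (rule order_trans)
      ultimately have "(H, S) \<in> (\<lambda>(n, E). Graph {..<n} E) ` ({..L} \<times> Pow (Pow {..<L})) \<times> Pow {..<L}"
        using nL(1) by (auto simp: H_def intro!: image_eqI[of _ _ "(n, E)"])
      then show ?thesis using valid by (simp add: D_def)
    qed
    then have le: "\<mu> H S \<le> M" by (rule M)
    have edges_in: "(`) (\<phi> i) ` E \<subseteq> edges G" if "i < M" for i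
      using \<phi> F that by metis
    have "in_class (glued_copies (\<mu> H S) H S) C"
    proof (rule glued_copies_in_class[OF assms(2) G, where \<phi> = \<phi>])
      fix i assume "i < \<mu> H S"
      then have i: "i < M" using le by simp
      show "inj_on (\<phi> i) (verts H)" using \<phi> i by (simp add: H_def)
      show "(`) (\<phi> i) ` edges H \<subseteq> edges G" using edges_in[OF i] by (simp add: H_def)
      have "\<phi> i ` e \<subseteq> verts G" if "e \<in> E" for e
        using edges_in[OF i] simple that unfolding simple_graph_def by blast
      then have "\<phi> i ` \<Union>E \<subseteq> verts G" by blast
      then show "\<phi> i ` verts H \<subseteq> verts G" using E by (simp add: H_def)
    next
      fix i j s t
      assume "i < \<mu> H S" "j < \<mu> H S" "i \<noteq> j" "s \<in> verts H" "t \<in> verts H"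
      then show "\<phi> i s = \<phi> j t \<longleftrightarrow> s = t \<and> s \<in> S" using meet le by (simp add: H_def)
    qed (use S H in \<open>simp_all add: H_def\<close>)
    then show False using \<mu>[OF valid] by blast
  qed
  then show "vertex_scattered k C" unfolding vertex_scattered_def by blast
qed

end
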